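(* Let $\mathbb{G}$ be a finite graph, $\eta\in\mathbb{R}^{V(\mathbb{G})}$ any realization of the external field, $J>0$, $h\in\mathbb{R}$, $\varepsilon>0$, $\beta\in(0,\infty]$. (1) For all $u,v\in V(\mathbb{G})$, $$\langle\sigma_u;\sigma_v\rangle=2\,\Big\langle\!\!\Big\langle \mathbf 1\big[u\stackrel{\mathcal D}{\longleftrightarrow}v\big]\Big\rangle\!\!\Big\rangle .$$ (2) For any $A\subset V(\mathbb{G})$ and $u\in V(\mathbb{G})$, $$\langle\sigma_u\rangle_{\mathbb{G}}^{A,+}=\tfrac12\left(\langle\sigma_u\rangle_{\mathbb{G}}^{A,+}-\langle\sigma_u\rangle_{\mathbb{G}}^{A,-}\right)=\Big\langle\mathbf 1\big[u\stackrel{\mathcal D}{\longleftrightarrow}A\big]\Big\rangle^{A,+/-}.$$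
   Context: Ising model: for $\sigma\in\{-1,1\}^{V(\mathbb{G})}$, $H(\sigma)=-J\sum_{\{u,v\}\in E(\mathbb{G})}\sigma_u\sigma_v-\sum_{v}(h+\varepsilon\eta_v)\sigma_v$; $\langle\cdot\rangle$ is expectation under the Gibbs measure proportional to $e^{-\beta H}$, and $\langle\cdot\rangle^{A,\pm}_{\mathbb{G}}$ under the Gibbs measure restricted to $\sigma\equiv\pm1$ on $A$. $\langle\sigma_u;\sigma_v\rangle=\langle\sigma_u\sigma_v\rangle-\langle\sigma_u\rangle\langle\sigma_v\rangle$. Extended model: $\bar{\mathbb{G}}$ is the graph whose vertices are $V(\mathbb{G})$ together with one midpoint $m_e$ for each $e\in E(\mathbb{G})$, with edges $\{v,m_e\}$ for $v\in e$. A configuration $\bar\sigma$ consists of $\sigma_v\in\{-1,1\}$ and $\kappa_{m_e}\in\{-1,0,1\}$. For $\beta<\infty$, $\bar{\mathbb{P}}_{\bar{\mathbb{G}}}(\bar\sigma)$ is proportional to $\prod_{(v,e):v\in e}W(\sigma_v,\kappa_{m_e})\cdot\exp(\beta\sum_v(h+\varepsilon\eta_v)\sigma_v)$, with $W(a,b)=\lambda(\delta_{a,b}+t\delta_{b,0})$, $t=(e^{2J\beta}-1)^{-1/2}$, $\lambda=(2\sinh(J\beta))^{1/2}$. $\bar{\mathbb{P}}^{A,\pm}_{\bar{\mathbb{G}}}$ is $\bar{\mathbb{P}}_{\bar{\mathbb{G}}}$ conditioned on $\sigma\equiv\pm1$ on $A$. For $\beta=\infty$ all measures are defined as the limits $\beta\to\infty$.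 For a pair of configurations $(\bar\sigma,\bar\sigma')$, the disagreement set is $\mathcal D=\{x\in\bar{\mathbb{G}}:\bar\sigma_x\ne\bar\sigma'_x\}$; $A\stackrel{\mathcal D}{\longleftrightarrow}B$ means there is a path in $\bar{\mathbb{G}}$ from $A$ to $B$ all of whose vertices (including endpoints) lie in $\mathcal D$. $\langle\cdot\rangle^{A,+/-}$ is expectation over $(\bar\sigma^+,\bar\sigma^-)\sim\bar{\mathbb{P}}^{A,+}_{\bar{\mathbb{G}}}\otimes\bar{\mathbb{P}}^{A,-}_{\bar{\mathbb{G}}}$ and $\langle\langle\cdot\rangle\rangle$ is expectation over two independent copies of $\bar{\mathbb{P}}_{\bar{\mathbb{G}}}$.
   Formalization: In (2), the first equality ⟨σ_u⟩^{A,+} = ½(⟨σ_u⟩^{A,+} − ⟨σ_u⟩^{A,−}) is false for general fields (e.g. h=1, η=0, no edges); it is asserted only when h+εη_v=0 for all v. The second equality and part (1) are proved for all fields. *)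

theory Defs
  imports "HOL-Probability.Probability"
begin

text \<open>
  The random field Ising model on a finite simple graph, its extension by three-valued edge
  variables, and the disagreement set of a pair of configurations of the extended model.
  Configurations are functions that are \<^const>\<open>undefined\<close> off their finite index set, so that
  each configuration space is a finite set.
\<close>

definition fin_graph :: "'v set \<Rightarrow> 'v set set \<Rightarrow> bool" where
  "fin_graph V E \<longleftrightarrow> finite V \<and> (\<forall>e\<in>E. e \<subseteq> V \<and> card e = 2)"

definition proportional_pmf :: "'a set \<Rightarrow> ('a \<Rightarrow> real) \<Rightarrow> 'a pmf" where
  "proportional_pmf S w = embed_pmf (\<lambda>x. if x \<in> S then w x / (\<Sum>y\<in>S. w y) else 0)"

text \<open>\<^const>\<open>embed_pmf\<close> is only meaningful for genuine mass functions; on finite sets it is one here.\<close>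

lemma pmf_proportional_pmf:
  assumes "finite S" "\<And>x. x \<in> S \<Longrightarrow> 0 \<le> w x" "0 < (\<Sum>y\<in>S. w y)"
  shows "pmf (proportional_pmf S w) x = (if x \<in> S then w x / (\<Sum>y\<in>S. w y) else 0)"
  unfolding proportional_pmf_def
proof (rule pmf_embed_pmf)
  show "0 \<le> (if x \<in> S then w x / (\<Sum>y\<in>S. w y) else 0)" for x
    using assms by (simp add: sum_nonneg)
  have "(\<integral>\<^sup>+x. ennreal (if x \<in> S then w x / (\<Sum>y\<in>S. w y) else 0) \<partial>count_space UNIV)
      = (\<Sum>x\<in>S. ennreal (w x / (\<Sum>y\<in>S. w y)))"
    using assms(1) by (subst nn_integral_count_space'[of S]) auto
  also have "\<dots> = ennreal (\<Sum>x\<in>S. w x / (\<Sum>y\<in>S. w y))"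
    using assms by (intro sum_ennreal) (simp add: sum_nonneg)
  also have "\<dots> = 1"
    using assms(3) by (simp flip: sum_divide_distrib)
  finally show "(\<integral>\<^sup>+x. ennreal (if x \<in> S then w x / (\<Sum>y\<in>S. w y) else 0) \<partial>count_space UNIV) = 1" .
qed

text \<open>
  A family of laws indexed by finite inverse temperatures, evaluated at an inverse temperature in
  \<open>(0, \<infinity>]\<close>: at \<open>\<infinity>\<close> it is the (pointwise) limit of the laws. The laws conditioned on boundary values
  are limits of conditioned laws, as the conditioning event may have mass 0 in the limit.
\<close>

definition at_inv_temp :: "(real \<Rightarrow> 'a pmf) \<Rightarrow> ereal \<Rightarrow> 'a pmf" where
  "at_inv_temp p \<beta> =
     (if \<beta> = \<infinity> then embed_pmf (\<lambda>x. Lim at_top (\<lambda>b. pmf (p b) x)) else p (real_of_ereal \<beta>))"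


subsection \<open>Ising model\<close>

definition ising_configs :: "'v set \<Rightarrow> ('v \<Rightarrow> real) set" where
  "ising_configs V = V \<rightarrow>\<^sub>E {-1, 1}"

text \<open>For an edge \<open>e = {u, v}\<close>, the product over \<open>w \<in> e\<close> is \<open>\<sigma> u * \<sigma> v\<close>.\<close>

definition hamiltonian ::
    "'v set \<Rightarrow> 'v set set \<Rightarrow> real \<Rightarrow> real \<Rightarrow> real \<Rightarrow> ('v \<Rightarrow> real) \<Rightarrow> ('v \<Rightarrow> real) \<Rightarrow> real" where
  "hamiltonian V E J h \<epsilon> \<eta> \<sigma> =
     - J * (\<Sum>e\<in>E. \<Prod>w\<in>e. \<sigma> w) - (\<Sum>v\<in>V. (h + \<epsilon> * \<eta> v) * \<sigma> v)"

definition ising_fin ::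
    "'v set \<Rightarrow> 'v set set \<Rightarrow> real \<Rightarrow> real \<Rightarrow> real \<Rightarrow> ('v \<Rightarrow> real) \<Rightarrow> real \<Rightarrow> ('v \<Rightarrow> real) pmf" where
  "ising_fin V E J h \<epsilon> \<eta> b =
     proportional_pmf (ising_configs V) (\<lambda>\<sigma>. exp (- b * hamiltonian V E J h \<epsilon> \<eta> \<sigma>))"

definition ising ::
    "'v set \<Rightarrow> 'v set set \<Rightarrow> real \<Rightarrow> real \<Rightarrow> real \<Rightarrow> ('v \<Rightarrow> real) \<Rightarrow> ereal \<Rightarrow> ('v \<Rightarrow> real) pmf" where
  "ising V E J h \<epsilon> \<eta> \<beta> = at_inv_temp (ising_fin V E J h \<epsilon> \<eta>) \<beta>"

text \<open>The argument \<open>s\<close> is the boundary value, \<open>1\<close> or \<open>-1\<close>, imposed on \<open>A\<close>.\<close>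

definition ising_bc ::
    "'v set \<Rightarrow> 'v set set \<Rightarrow> real \<Rightarrow> real \<Rightarrow> real \<Rightarrow> ('v \<Rightarrow> real) \<Rightarrow> 'v set \<Rightarrow> real \<Rightarrow> ereal
      \<Rightarrow> ('v \<Rightarrow> real) pmf" where
  "ising_bc V E J h \<epsilon> \<eta> A s \<beta> =
     at_inv_temp (\<lambda>b. cond_pmf (ising_fin V E J h \<epsilon> \<eta> b) {\<sigma>. \<forall>v\<in>A. \<sigma> v = s}) \<beta>"

definition truncated_corr :: "('v \<Rightarrow> real) pmf \<Rightarrow> 'v \<Rightarrow> 'v \<Rightarrow> real" where
  "truncated_corr p u v =
     measure_pmf.expectation p (\<lambda>\<sigma>. \<sigma> u * \<sigma> v)
       - measure_pmf.expectation p (\<lambda>\<sigma>. \<sigma> u) * measure_pmf.expectation p (\<lambda>\<sigma>. \<sigma> v)"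


subsection \<open>Extended model\<close>

text \<open>
  In the subdivided graph, \<open>Inl v\<close> is the original vertex \<open>v\<close> and \<open>Inr e\<close> the midpoint of \<open>e\<close>.
  An extended configuration \<open>s\<close> comprises the spins \<open>s (Inl v)\<close> and the edge variables \<open>s (Inr e)\<close>.
\<close>

definition ext_verts :: "'v set \<Rightarrow> 'v set set \<Rightarrow> ('v + 'v set) set" where
  "ext_verts V E = V <+> E"

definition ext_edges :: "'v set set \<Rightarrow> ('v + 'v set) set set" where
  "ext_edges E = {{Inl v, Inr e} | v e. e \<in> E \<and> v \<in> e}"

definition ext_configs :: "'v set \<Rightarrow> 'v set set \<Rightarrow> ('v + 'v set \<Rightarrow> real) set" where
  "ext_configs V E =
     (\<Pi>\<^sub>E x\<in>ext_verts V E. case x of Inl v \<Rightarrow> {-1, 1} | Inr e \<Rightarrow> {-1, 0, 1})"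

definition W :: "real \<Rightarrow> real \<Rightarrow> real \<Rightarrow> real \<Rightarrow> real" where
  "W J b x y =
     (let t = (exp (2 * J * b) - 1) powr (- 1 / 2);
          l = (2 * sinh (J * b)) powr (1 / 2)
      in l * (of_bool (x = y) + t * of_bool (y = 0)))"

definition ext_weight ::
    "'v set \<Rightarrow> 'v set set \<Rightarrow> real \<Rightarrow> real \<Rightarrow> real \<Rightarrow> ('v \<Rightarrow> real) \<Rightarrow> real
      \<Rightarrow> ('v + 'v set \<Rightarrow> real) \<Rightarrow> real" where
  "ext_weight V E J h \<epsilon> \<eta> b s =
     (\<Prod>(v, e)\<in>{(v, e). e \<in> E \<and> v \<in> e}. W J b (s (Inl v)) (s (Inr e)))
       * exp (b * (\<Sum>v\<in>V. (h + \<epsilon> * \<eta> v) * s (Inl v)))"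

definition ext_fin ::
    "'v set \<Rightarrow> 'v set set \<Rightarrow> real \<Rightarrow> real \<Rightarrow> real \<Rightarrow> ('v \<Rightarrow> real) \<Rightarrow> real
      \<Rightarrow> ('v + 'v set \<Rightarrow> real) pmf" where
  "ext_fin V E J h \<epsilon> \<eta> b = proportional_pmf (ext_configs V E) (ext_weight V E J h \<epsilon> \<eta> b)"

definition ext_law ::
    "'v set \<Rightarrow> 'v set set \<Rightarrow> real \<Rightarrow> real \<Rightarrow> real \<Rightarrow> ('v \<Rightarrow> real) \<Rightarrow> ereal
      \<Rightarrow> ('v + 'v set \<Rightarrow> real) pmf" where
  "ext_law V E J h \<epsilon> \<eta> \<beta> = at_inv_temp (ext_fin V E J h \<epsilon> \<eta>) \<beta>"

definition ext_bc ::
    "'v set \<Rightarrow> 'v set set \<Rightarrow> real \<Rightarrow> real \<Rightarrow> real \<Rightarrow> ('v \<Rightarrow> real) \<Rightarrow> 'v set \<Rightarrow> real \<Rightarrow> ereal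
      \<Rightarrow> ('v + 'v set \<Rightarrow> real) pmf" where
  "ext_bc V E J h \<epsilon> \<eta> A s \<beta> =
     at_inv_temp (\<lambda>b. cond_pmf (ext_fin V E J h \<epsilon> \<eta> b) {\<tau>. \<forall>v\<in>A. \<tau> (Inl v) = s}) \<beta>"


subsection \<open>Disagreement percolation\<close>

definition disagreement ::
    "'v set \<Rightarrow> 'v set set \<Rightarrow> ('v + 'v set \<Rightarrow> real) \<Rightarrow> ('v + 'v set \<Rightarrow> real) \<Rightarrow> ('v + 'v set) set" where
  "disagreement V E s s' = {x \<in> ext_verts V E. s x \<noteq> s' x}"

text \<open>A path may consist of a single vertex.\<close>

definition connected_within ::
    "'v set set \<Rightarrow> ('v + 'v set) set \<Rightarrow> ('v + 'v set) set \<Rightarrow> ('v + 'v set) set \<Rightarrow> bool" where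
  "connected_within E D A B \<longleftrightarrow>
     (\<exists>xs. xs \<noteq> [] \<and> hd xs \<in> A \<and> last xs \<in> B \<and> set xs \<subseteq> D
         \<and> successively (\<lambda>x y. {x, y} \<in> ext_edges E) xs)"

end

theory Submission
  imports Defs
begin

text \<open>
  Summing the extended weight over the edge variables gives the Boltzmann weight, so both sides are
  expectations over two independent copies of the extended model: \<open>\<langle>\<sigma>\<^sub>u; \<sigma>\<^sub>v\<rangle>\<close> is half the
  expectation of \<open>(\<sigma>\<^sub>u - \<sigma>'\<^sub>u) (\<sigma>\<^sub>v - \<sigma>'\<^sub>v)\<close>. If the disagreement cluster of \<open>u\<close> misses
  the target, exchanging the two copies on this cluster preserves the weight and flips the sign of
  \<open>\<sigma>\<^sub>u - \<sigma>'\<^sub>u\<close>, so these pairs contribute nothing. If it meets the target, then \<open>\<sigma> - \<sigma>'\<close> has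
  constant sign on the cluster, and the contribution is deterministic. Infinite inverse temperature
  is a limit: after rescaling by the largest exponential rate all weights converge.
\<close>

subsection \<open>Finitely supported laws and their limits\<close>

text \<open>An empty boundary set imposes the condition \<open>UNIV\<close>, so the free laws become
  a special case of the laws with boundary values.\<close>

lemma cond_pmf_UNIV: "cond_pmf p UNIV = p"
  by (rule pmf_eqI) (simp add: pmf_cond set_pmf_not_empty)

lemma set_pmf_proportional_pmf:
  assumes "finite S" "\<And>x. x \<in> S \<Longrightarrow> 0 \<le> w x" "0 < (\<Sum>y\<in>S. w y)"
  shows "set_pmf (proportional_pmf S w) \<subseteq> S"
  using pmf_proportional_pmf[OF assms] by (auto simp: set_pmf_iff split: if_splits)

lemma expectation_proportional_pmf:
  fixes f :: "'a \<Rightarrow> real"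
  assumes "finite S" "\<And>x. x \<in> S \<Longrightarrow> 0 \<le> w x" "0 < (\<Sum>y\<in>S. w y)"
  shows "measure_pmf.expectation (proportional_pmf S w) f
    = (\<Sum>x\<in>S. w x * f x) / (\<Sum>x\<in>S. w x)"
proof -
  have "measure_pmf.expectation (proportional_pmf S w) f
      = (\<Sum>x\<in>S. pmf (proportional_pmf S w) x * f x)"
    using set_pmf_proportional_pmf[OF assms] assms(1)
    by (subst integral_measure_pmf_real[of S]) (auto simp: mult.commute)
  also have "\<dots> = (\<Sum>x\<in>S. w x * f x) / (\<Sum>x\<in>S. w x)"
    by (simp add: pmf_proportional_pmf[OF assms] sum_divide_distrib)
  finally show ?thesis .
qed

lemma cond_proportional_pmf:
  assumes "finite S" "\<And>x. x \<in> S \<Longrightarrow> 0 \<le> w x" "0 < (\<Sum>y\<in>S \<inter> X. w y)"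
  shows "cond_pmf (proportional_pmf S w) X = proportional_pmf (S \<inter> X) w"
proof -
  have le: "(\<Sum>y\<in>S \<inter> X. w y) \<le> (\<Sum>y\<in>S. w y)"
    using assms(1,2) by (intro sum_mono2) auto
  have pos: "0 < (\<Sum>y\<in>S. w y)"
    using le assms(3) by linarith
  note pmf_S = pmf_proportional_pmf[OF assms(1,2) pos]
  \<comment> \<open>\<open>cond_pmf\<close> has its intended mass function only if the event meets
    the support; a point of nonzero weight in \<open>S \<inter> X\<close> provides this.\<close>
  have "set_pmf (proportional_pmf S w) \<inter> X \<noteq> {}"
  proof -
    obtain y where "y \<in> S \<inter> X" "w y \<noteq> 0"
      using assms(3) by (metis less_numeral_extra(3) sum.neutral)
    then show ?thesis
      using pos by (auto simp: set_pmf_iff pmf_S)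
  qed
  note pmf_cond = pmf_cond[OF this]
  have prob: "measure_pmf.prob (proportional_pmf S w) X = (\<Sum>y\<in>S \<inter> X. w y) / (\<Sum>y\<in>S. w y)"
  proof -
    have "measure_pmf.prob (proportional_pmf S w) X
        = measure_pmf.prob (proportional_pmf S w) (S \<inter> X)"
      using set_pmf_proportional_pmf[OF assms(1,2) pos]
      by (intro measure_pmf.finite_measure_eq_AE) (auto simp: AE_measure_pmf_iff)
    also have "\<dots> = (\<Sum>y\<in>S \<inter> X. w y) / (\<Sum>y\<in>S. w y)"
      using assms(1) by (simp add: measure_measure_pmf_finite pmf_S sum_divide_distrib)
    finally show ?thesis .
  qed
  show ?thesis
  proof (rule pmf_eqI)
    fix x
    have "pmf (proportional_pmf (S \<inter> X) w) x
        = (if x \<in> S \<inter> X then w x / (\<Sum>y\<in>S \<inter> X. w y) else 0)"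
      using assms by (intro pmf_proportional_pmf) auto
    then show "pmf (cond_pmf (proportional_pmf S w) X) x = pmf (proportional_pmf (S \<inter> X) w) x"
      using pos by (auto simp: pmf_cond prob pmf_S)
  qed
qed

lemma expectation_pair_pmf_finite:
  fixes f :: "'a \<times> 'b \<Rightarrow> real"
  assumes "finite S" "finite T" "set_pmf p \<subseteq> S" "set_pmf q \<subseteq> T"
  shows "measure_pmf.expectation (pair_pmf p q) f
    = (\<Sum>(x, y)\<in>S \<times> T. pmf p x * pmf q y * f (x, y))"
  using assms
  by (subst integral_measure_pmf_real[of "S \<times> T"])
    (auto simp: pmf_pair mult_ac intro!: sum.cong)

lemma expectation_pair_proportional_pmf:
  fixes f :: "'a \<times> 'b \<Rightarrow> real"
  assumes "finite S" "\<And>x. x \<in> S \<Longrightarrow> 0 \<le> w x" "0 < (\<Sum>x\<in>S. w x)"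
    and "finite T" "\<And>y. y \<in> T \<Longrightarrow> 0 \<le> w' y" "0 < (\<Sum>y\<in>T. w' y)"
  shows "measure_pmf.expectation (pair_pmf (proportional_pmf S w) (proportional_pmf T w')) f
    = (\<Sum>(x, y)\<in>S \<times> T. w x * w' y * f (x, y)) / ((\<Sum>x\<in>S. w x) * (\<Sum>y\<in>T. w' y))"
  using assms
  by (subst expectation_pair_pmf_finite[of S T])
    (auto simp: set_pmf_proportional_pmf pmf_proportional_pmf sum_divide_distrib split_def
      intro!: sum.cong dest: set_pmf_proportional_pmf[THEN subsetD, rotated 3])

text \<open>The finite set \<open>S\<close> is common to all large \<open>b\<close>, so no mass can
  escape in the limit. Inclusion is asked only eventually because the laws are controlled only for
  positive \<open>b\<close>.\<close>

definition converging_laws :: "(real \<Rightarrow> 'a pmf) \<Rightarrow> 'a set \<Rightarrow> bool" where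
  "converging_laws p S \<longleftrightarrow> finite S \<and> (\<forall>\<^sub>F b in at_top. set_pmf (p b) \<subseteq> S)
     \<and> (\<forall>x\<in>S. \<exists>l. ((\<lambda>b. pmf (p b) x) \<longlongrightarrow> l) at_top)"

text \<open>Masses outside \<open>S\<close> are eventually 0 and a finite sum passes to the limit,
  so the limiting masses are nonnegative with total 1. Hence \<open>embed_pmf\<close> in
  \<open>at_inv_temp\<close> yields a genuine law with these masses.\<close>

lemma
  assumes "converging_laws p S"
  shows tendsto_pmf_at_inv_temp: "((\<lambda>b. pmf (p b) x) \<longlongrightarrow> pmf (at_inv_temp p \<infinity>) x) at_top"
    and set_pmf_at_inv_temp: "set_pmf (at_inv_temp p \<infinity>) \<subseteq> S"
proof -
  define l where "l x = Lim at_top (\<lambda>b. pmf (p b) x)" for x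
  have fin: "finite S" and ev: "\<forall>\<^sub>F b in at_top. set_pmf (p b) \<subseteq> S"
    using assms by (auto simp: converging_laws_def)
  have zero: "\<forall>\<^sub>F b in at_top. pmf (p b) x = 0" if "x \<notin> S" for x
    using ev by eventually_elim (use that in \<open>auto simp: set_pmf_iff\<close>)
  have lim: "((\<lambda>b. pmf (p b) x) \<longlongrightarrow> l x) at_top" for x
  proof -
    have "\<exists>l. ((\<lambda>b. pmf (p b) x) \<longlongrightarrow> l) at_top"
      using assms zero[of x] by (cases "x \<in> S") (auto simp: converging_laws_def intro: tendsto_eventually)
    then show ?thesis
      unfolding l_def by (auto simp: tendsto_Lim)
  qed
  have l0: "l x = 0" if "x \<notin> S" for x
    using tendsto_unique[OF _ lim tendsto_eventually[OF zero[OF that]]] by simp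
  have nonneg: "0 \<le> l x" for x
    by (rule tendsto_lowerbound[OF lim]) auto
  have "((\<lambda>b. \<Sum>x\<in>S. pmf (p b) x) \<longlongrightarrow> (\<Sum>x\<in>S. l x)) at_top"
    by (intro tendsto_sum lim)
  moreover have "\<forall>\<^sub>F b in at_top. (\<Sum>x\<in>S. pmf (p b) x) = 1"
    using ev by eventually_elim (use fin in \<open>rule sum_pmf_eq_1\<close>)
  ultimately have sum1: "(\<Sum>x\<in>S. l x) = 1"
    using tendsto_unique[OF trivial_limit_at_top_linorder _ tendsto_eventually] by blast
  have "(\<integral>\<^sup>+x. ennreal (l x) \<partial>count_space UNIV) = (\<Sum>x\<in>S. ennreal (l x))"
    using fin l0 by (subst nn_integral_count_space'[of S]) auto
  also have "\<dots> = 1"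
    using sum1 nonneg by (simp add: sum_ennreal)
  finally have pmf: "pmf (at_inv_temp p \<infinity>) y = l y" for y
    unfolding at_inv_temp_def l_def[symmetric] using nonneg by (simp add: pmf_embed_pmf)
  show "((\<lambda>b. pmf (p b) x) \<longlongrightarrow> pmf (at_inv_temp p \<infinity>) x) at_top"
    using lim by (simp add: pmf)
  show "set_pmf (at_inv_temp p \<infinity>) \<subseteq> S"
    by (metis l0 pmf set_pmf_iff subsetI)
qed

lemma tendsto_expectation_at_inv_temp:
  fixes f :: "'a \<Rightarrow> real"
  assumes "converging_laws p S"
  shows "((\<lambda>b. measure_pmf.expectation (p b) f)
    \<longlongrightarrow> measure_pmf.expectation (at_inv_temp p \<infinity>) f) at_top"
proof -
  have fin: "finite S" and ev: "\<forall>\<^sub>F b in at_top. set_pmf (p b) \<subseteq> S"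
    using assms by (auto simp: converging_laws_def)
  have "((\<lambda>b. \<Sum>x\<in>S. f x * pmf (p b) x)
      \<longlongrightarrow> (\<Sum>x\<in>S. f x * pmf (at_inv_temp p \<infinity>) x)) at_top"
    by (intro tendsto_intros tendsto_pmf_at_inv_temp[OF assms])
  moreover have "\<forall>\<^sub>F b in at_top.
      measure_pmf.expectation (p b) f = (\<Sum>x\<in>S. f x * pmf (p b) x)"
    using ev by eventually_elim (use fin in \<open>auto intro!: integral_measure_pmf_real\<close>)
  moreover have "measure_pmf.expectation (at_inv_temp p \<infinity>) f
      = (\<Sum>x\<in>S. f x * pmf (at_inv_temp p \<infinity>) x)"
    using fin set_pmf_at_inv_temp[OF assms] by (auto intro!: integral_measure_pmf_real)
  ultimately show ?thesis
    by (simp add: tendsto_cong)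
qed

lemma tendsto_expectation_pair_at_inv_temp:
  fixes f :: "'a \<times> 'b \<Rightarrow> real"
  assumes "converging_laws p S" "converging_laws q T"
  shows "((\<lambda>b. measure_pmf.expectation (pair_pmf (p b) (q b)) f)
    \<longlongrightarrow> measure_pmf.expectation (pair_pmf (at_inv_temp p \<infinity>) (at_inv_temp q \<infinity>)) f) at_top"
proof -
  have fin: "finite S" "finite T"
    and ev: "\<forall>\<^sub>F b in at_top. set_pmf (p b) \<subseteq> S" "\<forall>\<^sub>F b in at_top. set_pmf (q b) \<subseteq> T"
    using assms by (auto simp: converging_laws_def)
  have "((\<lambda>b. \<Sum>(x, y)\<in>S \<times> T. pmf (p b) x * pmf (q b) y * f (x, y))
      \<longlongrightarrow> (\<Sum>(x, y)\<in>S \<times> T. pmf (at_inv_temp p \<infinity>) x * pmf (at_inv_temp q \<infinity>) y * f (x, y)))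
      at_top"
    unfolding split_def
    by (intro tendsto_intros tendsto_pmf_at_inv_temp[OF assms(1)] tendsto_pmf_at_inv_temp[OF assms(2)])
  moreover have "\<forall>\<^sub>F b in at_top. measure_pmf.expectation (pair_pmf (p b) (q b)) f
      = (\<Sum>(x, y)\<in>S \<times> T. pmf (p b) x * pmf (q b) y * f (x, y))"
    using ev by eventually_elim (rule expectation_pair_pmf_finite[OF fin])
  moreover have "measure_pmf.expectation (pair_pmf (at_inv_temp p \<infinity>) (at_inv_temp q \<infinity>)) f
      = (\<Sum>(x, y)\<in>S \<times> T. pmf (at_inv_temp p \<infinity>) x * pmf (at_inv_temp q \<infinity>) y * f (x, y))"
    using set_pmf_at_inv_temp[OF assms(1)] set_pmf_at_inv_temp[OF assms(2)]
    by (intro expectation_pair_pmf_finite[OF fin])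
  ultimately show ?thesis
    by (simp add: tendsto_cong)
qed

section \<open>Convergence of laws whose weights have exponential rates\<close>

lemma exp_neg_mult_tendsto_0:
  fixes a :: real
  assumes "a > 0"
  shows "((\<lambda>b. exp (- (b * a))) \<longlongrightarrow> 0) at_top"
proof -
  have "filterlim (\<lambda>b. b * a) at_top at_top"
    using assms by (intro filterlim_at_top_mult_tendsto_pos[where c = a] filterlim_ident) auto
  then show ?thesis
    by (intro filterlim_compose[OF exp_at_bot]) (simp add: filterlim_uminus_at_bot)
qed

text \<open>After division by \<open>exp (b * M)\<close>, \<open>M\<close> the largest exponent present, all weights converge.\<close>

lemma converging_laws_proportional_pmf:
  fixes w :: "real \<Rightarrow> 'a \<Rightarrow> real" and c L :: "'a \<Rightarrow> real"
  assumes "finite S"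
    and nonneg: "\<And>b x. b > 0 \<Longrightarrow> x \<in> S \<Longrightarrow> 0 \<le> w b x"
    and pos: "\<And>b. b > 0 \<Longrightarrow> 0 < (\<Sum>x\<in>S. w b x)"
    and lim: "\<And>x. x \<in> S \<Longrightarrow> ((\<lambda>b. w b x * exp (- (b * c x))) \<longlongrightarrow> L x) at_top"
    and vanish: "\<And>b x. b > 0 \<Longrightarrow> x \<in> S \<Longrightarrow> L x = 0 \<Longrightarrow> w b x = 0"
    and p: "\<And>b. b > 0 \<Longrightarrow> p b = proportional_pmf S (w b)"
  shows "converging_laws p S"
proof -
  have b_pos: "\<forall>\<^sub>F b::real in at_top. b > 0"
    by (rule eventually_gt_at_top)
  have L_nonneg: "0 \<le> L x" if "x \<in> S" for x
    by (rule tendsto_lowerbound[OF lim[OF that]])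
      (use b_pos in eventually_elim, auto intro!: mult_nonneg_nonneg nonneg that)
  \<comment> \<open>By \<open>vanish\<close>, points outside \<open>S'\<close> have weight 0 at
    every positive \<open>b\<close>, so their \<open>c\<close> says nothing about growth; the
    largest exponent is taken over \<open>S'\<close> only.\<close>
  define S' where "S' = {x \<in> S. L x \<noteq> 0}"
  have "S' \<noteq> {}"
  proof
    assume "S' = {}"
    then have "(\<Sum>x\<in>S. w 1 x) = 0"
      by (intro sum.neutral) (auto simp: S'_def vanish)
    then show False
      using pos[of 1] by simp
  qed
  moreover have "finite S'"
    using assms(1) by (simp add: S'_def)
  ultimately obtain x0 where x0: "x0 \<in> S'" "\<And>x. x \<in> S' \<Longrightarrow> c x \<le> c x0"
    using ex_is_arg_min_if_finite[of S' "\<lambda>x. - c x"] by (auto simp: is_arg_min_linorder)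
  define v where "v b x = w b x * exp (- (b * c x0))" for b x
  \<comment> \<open>Relative to the rate \<open>c x0\<close>, a smaller exponent decays to 0 and an
    equal one leaves the limit \<open>L x\<close>.\<close>
  define l where "l x = (if c x = c x0 then L x else 0)" for x
  have v_lim: "((\<lambda>b. v b x) \<longlongrightarrow> l x) at_top" if x: "x \<in> S" for x
  proof (cases "L x = 0")
    case True
    have "\<forall>\<^sub>F b in at_top. v b x = 0"
      using b_pos by eventually_elim (simp add: v_def vanish x True)
    then show ?thesis
      using True by (auto simp: l_def intro: tendsto_eventually)
  next
    case False
    then have le: "c x \<le> c x0"
      using x0(2) x by (simp add: S'_def)
    have "((\<lambda>b. exp (- (b * (c x0 - c x)))) \<longlongrightarrow> of_bool (c x = c x0)) at_top"
    proof (cases "c x = c x0")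
      case False
      then have "c x0 - c x > 0"
        using le by simp
      then have "((\<lambda>b. exp (- (b * (c x0 - c x)))) \<longlongrightarrow> 0) at_top"
        by (rule exp_neg_mult_tendsto_0)
      then show ?thesis
        using False by simp
    qed simp
    from tendsto_mult[OF lim[OF x] this] show ?thesis
      by (cases "c x = c x0") (simp_all add: v_def l_def mult.assoc algebra_simps flip: exp_add)
  qed
  \<comment> \<open>The term of \<open>x0\<close> is positive, so the quotients below have a nonzero
    limiting denominator.\<close>
  have "0 < (\<Sum>x\<in>S. l x)"
    using assms(1) x0(1) L_nonneg by (intro sum_pos2[of S x0]) (auto simp: l_def S'_def order_le_less)
  then have ratio: "((\<lambda>b. v b x / (\<Sum>y\<in>S. v b y)) \<longlongrightarrow> l x / (\<Sum>y\<in>S. l y)) at_top"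
    if "x \<in> S" for x
    using that by (intro tendsto_divide tendsto_sum v_lim) auto
  have pmf: "pmf (p b) x = v b x / (\<Sum>y\<in>S. v b y)" if "x \<in> S" "b > 0" for x b
    using that assms(1)
    by (simp add: p pmf_proportional_pmf nonneg pos v_def flip: sum_distrib_right)
  have "((\<lambda>b. pmf (p b) x) \<longlongrightarrow> l x / (\<Sum>y\<in>S. l y)) at_top" if "x \<in> S" for x
    using ratio[OF that]
    by (rule Lim_transform_eventually) (use b_pos in eventually_elim, simp add: pmf that)
  moreover have "\<forall>\<^sub>F b in at_top. set_pmf (p b) \<subseteq> S"
    using b_pos by eventually_elim (simp add: p set_pmf_proportional_pmf assms(1) nonneg pos)
  ultimately show ?thesis
    using assms(1) unfolding converging_laws_def by blast
qed

subsection \<open>The edge weights\<close>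

text \<open>Since \<open>x\<close> is nonzero, the two indicators in \<open>W\<close> exclude each
  other. The closed form exposes the exponential rates \<open>- J / 2\<close> and
  \<open>J / 2\<close>, up to a square root tending to 1.\<close>

lemma W_eq:
  assumes "b > 0" "J > 0" "x \<noteq> 0"
  shows "W J b x y = (if y = 0 then exp (- (J * b / 2))
    else if x = y then exp (J * b / 2) * sqrt (1 - exp (- (2 * J * b))) else 0)"
proof -
  define a where "a = J * b"
  \<comment> \<open>\<open>r\<close> is the factor shared by both roots:
    \<open>exp (2 * a) - 1 = (exp a * r)\<^sup>2\<close> and
    \<open>2 * sinh a = (exp (a / 2) * r)\<^sup>2\<close>. It cancels in the product of the two
    constants of \<open>W\<close>.\<close>
  define r where "r = sqrt (1 - exp (- (2 * a)))"
  have "a > 0"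
    using assms by (simp add: a_def)
  then have r_pos: "r > 0"
    by (simp add: r_def)
  then have r2: "r\<^sup>2 = 1 - exp (- (2 * a))"
    using r_def by auto
  have "(exp a * r)\<^sup>2 = exp (2 * a) * (1 - exp (- (2 * a)))"
    unfolding power_mult_distrib r2 exp_double ..
  also have "\<dots> = exp (2 * a) - 1"
    by (simp add: right_diff_distrib exp_minus)
  finally have "exp (2 * J * b) - 1 = (exp a * r)\<^sup>2"
    by (simp add: a_def mult.assoc)
  moreover have "sqrt ((exp a * r)\<^sup>2) = exp a * r"
    using r_pos by (intro real_sqrt_unique) auto
  moreover have "- 1 / 2 = - (1 / 2 :: real)"
    by simp
  ultimately have t: "(exp (2 * J * b) - 1) powr (- 1 / 2) = 1 / (exp a * r)"
    using powr_minus_divide[of "(exp a * r)\<^sup>2" "1 / 2"] powr_half_sqrt[of "(exp a * r)\<^sup>2"]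
    by simp
  have "(exp (a / 2) * r)\<^sup>2 = exp (2 * (a / 2)) * (1 - exp (- (2 * a)))"
    unfolding power_mult_distrib r2 exp_double ..
  also have "\<dots> = 2 * sinh a"
    by (simp add: right_diff_distrib sinh_field_def flip: exp_add)
  finally have "2 * sinh a = (exp (a / 2) * r)\<^sup>2" ..
  then have l: "(2 * sinh (J * b)) powr (1 / 2) = exp (a / 2) * r"
    using r_pos by (simp add: a_def powr_half_sqrt)
  have "exp (a / 2) * exp (a / 2) = exp a"
    by (simp flip: exp_add)
  then have "exp (a / 2) * r * (1 / (exp a * r)) = exp (- (a / 2))"
    using r_pos by (simp add: exp_minus field_simps)
  then show ?thesis
    using assms(3) unfolding W_def Let_def t l by (auto simp: a_def r_def mult.assoc)
qed

lemma W_nonneg: "b > 0 \<Longrightarrow> J > 0 \<Longrightarrow> x \<noteq> 0 \<Longrightarrow> 0 \<le> W J b x y"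
  by (simp add: W_eq)

text \<open>The value 0 always contributes \<open>exp (- (J * b))\<close>; the common spin value
  adds \<open>exp (J * b) - exp (- (J * b))\<close> exactly when the two spins agree.\<close>

lemma sum_W_edge:
  assumes "b > 0" "J > 0" "x \<in> {-1, 1}" "y \<in> {-1, 1}"
  shows "(\<Sum>k\<in>{-1, 0, 1}. W J b x k * W J b y k) = exp (b * J * (x * y))"
proof -
  have "exp (J * b / 2) * sqrt (1 - exp (- (2 * J * b))) * (exp (J * b / 2) * sqrt (1 - exp (- (2 * J * b))))
      = exp (J * b) - exp (- (J * b))"
    using assms(1,2)
    by (simp add: mult_ac right_diff_distrib flip: exp_add)
  moreover have "exp (- (J * b / 2)) * exp (- (J * b / 2)) = exp (- (J * b))"
    by (simp flip: exp_add)
  ultimately show ?thesis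
    using assms by (auto simp: W_eq mult_ac)
qed

text \<open>Once the rates seen in \<open>W_eq\<close> are removed, what remains is 1, a square root
  tending to 1, or 0 at a mismatch. This feeds the convergence of the extended weights.\<close>

lemma W_tendsto:
  assumes "J > 0" "x \<noteq> 0"
  shows "((\<lambda>b. W J b x y * exp (- (b * (if y = 0 then - J / 2 else J / 2))))
    \<longlongrightarrow> of_bool (y = 0 \<or> x = y)) at_top"
proof -
  have "((\<lambda>b. sqrt (1 - exp (- (b * (2 * J))))) \<longlongrightarrow> sqrt (1 - 0)) at_top"
    using assms by (intro tendsto_intros exp_neg_mult_tendsto_0) simp
  then have "((\<lambda>b. if y = 0 then 1 else if x = y then sqrt (1 - exp (- (b * (2 * J)))) else 0)
      \<longlongrightarrow> of_bool (y = 0 \<or> x = y)) at_top"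
    by auto
  then show ?thesis
  proof (rule Lim_transform_eventually)
    show "\<forall>\<^sub>F b in at_top. (if y = 0 then 1 else if x = y then sqrt (1 - exp (- (b * (2 * J)))) else 0)
        = W J b x y * exp (- (b * (if y = 0 then - J / 2 else J / 2)))"
      using eventually_gt_at_top[of 0]
    proof eventually_elim
      case (elim b)
      have "exp (J * b / 2) * r * exp (- (b * J / 2)) = r"
        "exp (- (J * b / 2)) * exp (- (b * (- J / 2))) = 1" for r :: real
        by (simp_all add: exp_minus mult.commute)
      with elim show ?case
        using assms by (auto simp: W_eq mult_ac)
    qed
  qed
qed

subsection \<open>Disagreement clusters\<close>

text \<open>Empty unless \<open>x\<close> lies in \<open>D\<close>, because the endpoints of a path
  must lie in \<open>D\<close> too.\<close>

definition cluster :: "'v set set \<Rightarrow> ('v + 'v set) set \<Rightarrow> 'v + 'v set \<Rightarrow> ('v + 'v set) set" where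
  "cluster E D x = {y. connected_within E D {x} {y}}"

lemma connected_within_iff_cluster: "connected_within E D {x} B \<longleftrightarrow> cluster E D x \<inter> B \<noteq> {}"
  unfolding cluster_def connected_within_def by blast

lemma cluster_subset: "cluster E D x \<subseteq> D"
  unfolding cluster_def connected_within_def by (auto dest: last_in_set)

lemma source_mem_if_mem_cluster: "y \<in> cluster E D x \<Longrightarrow> x \<in> D"
  unfolding cluster_def connected_within_def by (auto dest: hd_in_set)

lemma source_mem_cluster: "x \<in> D \<Longrightarrow> x \<in> cluster E D x"
  unfolding cluster_def connected_within_def by (auto intro!: exI[of _ "[x]"])

lemma cluster_closed:
  assumes "y \<in> cluster E D x" "z \<in> D" "{y, z} \<in> ext_edges E"
  shows "z \<in> cluster E D x"
proof -
  obtain xs where "xs \<noteq> []" "hd xs = x" "last xs = y" "set xs \<subseteq> D"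
    "successively (\<lambda>x y. {x, y} \<in> ext_edges E) xs"
    using assms(1) unfolding cluster_def connected_within_def by auto
  then show ?thesis
    using assms(2,3) unfolding cluster_def connected_within_def
    by (auto intro!: exI[of _ "xs @ [z]"] simp: successively_append_iff)
qed

text \<open>Meant for the sign of \<open>s - s'\<close>, which is carried along a path one edge at a
  time.\<close>

lemma cluster_induct [consumes 1, case_names source step]:
  assumes "y \<in> cluster E D x" "P x"
    and step: "\<And>y z. y \<in> D \<Longrightarrow> z \<in> D \<Longrightarrow> {y, z} \<in> ext_edges E \<Longrightarrow> P y \<Longrightarrow> P z"
  shows "P y"
proof -
  obtain xs where "xs \<noteq> []" "hd xs = x" "last xs = y" "set xs \<subseteq> D"
    "successively (\<lambda>x y. {x, y} \<in> ext_edges E) xs"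
    using assms(1) unfolding cluster_def connected_within_def by auto
  then show ?thesis
    using assms(2)
  proof (induction xs arbitrary: x rule: induct_list012)
    case (3 x1 x2 xs)
    then show ?case
      using step[of x1 x2] by auto
  qed auto
qed

text \<open>Exchanging two values at a point does not affect whether they differ. Hence switching a
  disagreement cluster leaves that cluster in place and is an involution.\<close>

lemma disagreement_override_on:
  "disagreement V E (override_on s s' C) (override_on s' s C) = disagreement V E s s'"
  by (auto simp: disagreement_def override_on_def)

subsection \<open>Switching disagreement clusters\<close>

locale extended_ising =
  fixes V :: "'v set" and E :: "'v set set" and J h \<epsilon> :: real and \<eta> :: "'v \<Rightarrow> real"
  assumes graph: "fin_graph V E" and J_pos: "J > 0"
begin

abbreviation incidences :: "('v \<times> 'v set) set" where
  "incidences \<equiv> {(v, e). e \<in> E \<and> v \<in> e}"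

abbreviation field_sum :: "('v \<Rightarrow> real) \<Rightarrow> real" where
  "field_sum \<sigma> \<equiv> \<Sum>v\<in>V. (h + \<epsilon> * \<eta> v) * \<sigma> v"

abbreviation boltzmann :: "real \<Rightarrow> ('v \<Rightarrow> real) \<Rightarrow> real" where
  "boltzmann b \<sigma> \<equiv> exp (- b * hamiltonian V E J h \<epsilon> \<eta> \<sigma>)"

abbreviation weight :: "real \<Rightarrow> ('v + 'v set \<Rightarrow> real) \<Rightarrow> real" where
  "weight \<equiv> ext_weight V E J h \<epsilon> \<eta>"

text \<open>For empty \<open>A\<close> this is the whole configuration space whatever
  \<open>a\<close> is, so free and fixed boundaries are treated together.\<close>

definition ising_space :: "'v set \<Rightarrow> real \<Rightarrow> ('v \<Rightarrow> real) set" where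
  "ising_space A a = ising_configs V \<inter> {\<sigma>. \<forall>v\<in>A. \<sigma> v = a}"

definition ext_space :: "'v set \<Rightarrow> real \<Rightarrow> ('v + 'v set \<Rightarrow> real) set" where
  "ext_space A a = ext_configs V E \<inter> {s. \<forall>v\<in>A. s (Inl v) = a}"

lemma finite_V: "finite V" and edge_subset: "e \<in> E \<Longrightarrow> e \<subseteq> V" and card_edge: "e \<in> E \<Longrightarrow> card e = 2"
  using graph by (auto simp: fin_graph_def)

lemma finite_E: "finite E"
  using finite_V edge_subset by (meson PowI finite_Pow_iff finite_subset subsetI)

lemma finite_edge: "e \<in> E \<Longrightarrow> finite e"
  using finite_V edge_subset finite_subset by blast

lemma finite_incidences: "finite incidences"
  by (rule finite_subset[of _ "V \<times> E"]) (use edge_subset finite_V finite_E in auto)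

text \<open>Grouping incidences by edge makes the weight a product in which each factor involves a
  single edge variable.\<close>

lemma prod_incidences: "(\<Prod>(v, e)\<in>incidences. g v e) = (\<Prod>e\<in>E. \<Prod>v\<in>e. g v e)"
proof -
  have "(\<Prod>e\<in>E. \<Prod>v\<in>e. g v e) = (\<Prod>(e, v)\<in>(SIGMA e:E. e). g v e)"
    by (rule prod.Sigma) (auto simp: finite_E finite_edge)
  also have "\<dots> = (\<Prod>(v, e)\<in>incidences. g v e)"
    by (rule prod.reindex_bij_witness[of _ "\<lambda>(v, e). (e, v)" "\<lambda>(e, v). (v, e)"]) auto
  finally show ?thesis ..
qed

section \<open>Configurations with boundary values, and the marginal on the spins\<close>

lemma finite_ising_space: "finite (ising_space A a)"
  unfolding ising_space_def ising_configs_def using finite_V by (simp add: finite_PiE)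

lemma finite_ext_space: "finite (ext_space A a)"
  unfolding ext_space_def ext_configs_def ext_verts_def
  using finite_V finite_E by (auto intro!: finite_Int finite_PiE split: sum.splits)

lemma ext_space_spin: "s \<in> ext_space A a \<Longrightarrow> v \<in> V \<Longrightarrow> s (Inl v) \<in> {-1, 1}"
  unfolding ext_space_def ext_configs_def ext_verts_def by (force simp: PiE_iff)

lemma ext_space_spin_nonzero: "s \<in> ext_space A a \<Longrightarrow> v \<in> V \<Longrightarrow> s (Inl v) \<noteq> 0"
  using ext_space_spin by fastforce

lemma ext_space_case_sum_iff:
  "case_sum \<sigma> \<kappa> \<in> ext_space A a \<longleftrightarrow> \<sigma> \<in> ising_space A a \<and> \<kappa> \<in> E \<rightarrow>\<^sub>E {-1, 0, 1}"
  unfolding ext_space_def ising_space_def ext_configs_def ising_configs_def ext_verts_def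
  by (auto simp: PiE_iff extensional_def split: sum.splits)

lemma weight_nonneg:
  assumes "b > 0" "s \<in> ext_space A a"
  shows "0 \<le> weight b s"
  unfolding ext_weight_def using assms J_pos edge_subset
  by (auto intro!: mult_nonneg_nonneg prod_nonneg W_nonneg dest: ext_space_spin_nonzero)

text \<open>Given the spins, the edge variables are independent: distributivity turns the sum over
  edge configurations into a product over edges of the sums computed in
  \<open>sum_W_edge\<close>.\<close>

lemma sum_weight_fibre:
  assumes "b > 0" "\<sigma> \<in> ising_space A a"
  shows "(\<Sum>\<kappa>\<in>E \<rightarrow>\<^sub>E {-1, 0, 1}. weight b (case_sum \<sigma> \<kappa>)) = boltzmann b \<sigma>"
proof -
  have edge: "(\<Sum>k\<in>{-1, 0, 1}. \<Prod>v\<in>e. W J b (\<sigma> v) k) = exp (b * J * (\<Prod>v\<in>e. \<sigma> v))" if "e \<in> E" for e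
  proof -
    obtain x y where "e = {x, y}" "x \<noteq> y"
      using card_edge[OF \<open>e \<in> E\<close>] by (meson card_2_iff)
    moreover have "\<sigma> v \<in> {-1, 1}" if "v \<in> e" for v
      using assms(2) edge_subset[OF \<open>e \<in> E\<close>] that by (auto simp: ising_space_def ising_configs_def PiE_iff)
    ultimately show ?thesis
      using sum_W_edge[OF assms(1) J_pos, of "\<sigma> x" "\<sigma> y"] by simp
  qed
  have "(\<Sum>\<kappa>\<in>E \<rightarrow>\<^sub>E {-1, 0, 1}. weight b (case_sum \<sigma> \<kappa>))
      = (\<Sum>\<kappa>\<in>E \<rightarrow>\<^sub>E {-1, 0, 1}. \<Prod>e\<in>E. \<Prod>v\<in>e. W J b (\<sigma> v) (\<kappa> e)) * exp (b * field_sum \<sigma>)"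
    by (simp add: ext_weight_def prod_incidences sum_distrib_right)
  also have "(\<Sum>\<kappa>\<in>E \<rightarrow>\<^sub>E {-1, 0, 1}. \<Prod>e\<in>E. \<Prod>v\<in>e. W J b (\<sigma> v) (\<kappa> e))
      = (\<Prod>e\<in>E. \<Sum>k\<in>{-1, 0, 1}. \<Prod>v\<in>e. W J b (\<sigma> v) k)"
    by (rule prod_sum_PiE[symmetric]) (auto simp: finite_E)
  also have "\<dots> = (\<Prod>e\<in>E. exp (b * J * (\<Prod>v\<in>e. \<sigma> v)))"
    by (rule prod.cong) (simp_all only: edge)
  also have "\<dots> * exp (b * field_sum \<sigma>) = boltzmann b \<sigma>"
    by (simp add: hamiltonian_def exp_sum[OF finite_E, symmetric] sum_distrib_left algebra_simps
        flip: exp_add sum.distrib)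
  finally show ?thesis .
qed

text \<open>Moves Ising sums to the extended model, where clusters can be exchanged. As
  \<open>f\<close> sees only the spins, the edge variables can be summed out fibre by fibre.\<close>

lemma sum_weight_marginal:
  assumes "b > 0"
  shows "(\<Sum>s\<in>ext_space A a. weight b s * f (\<lambda>v. s (Inl v)))
    = (\<Sum>\<sigma>\<in>ising_space A a. boltzmann b \<sigma> * f \<sigma>)"
proof -
  have "(\<Sum>s\<in>ext_space A a. weight b s * f (\<lambda>v. s (Inl v)))
      = (\<Sum>(\<sigma>, \<kappa>)\<in>ising_space A a \<times> (E \<rightarrow>\<^sub>E {-1, 0, 1}). weight b (case_sum \<sigma> \<kappa>) * f \<sigma>)"
  proof (rule sum.reindex_bij_witness[of _ "\<lambda>(\<sigma>, \<kappa>). case_sum \<sigma> \<kappa>" "\<lambda>s. (s \<circ> Inl, s \<circ> Inr)"])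
    fix s assume s: "s \<in> ext_space A a"
    have "case_sum (s \<circ> Inl) (s \<circ> Inr) = s"
      by (simp add: fun_eq_iff split: sum.split)
    with s show "(s \<circ> Inl, s \<circ> Inr) \<in> ising_space A a \<times> (E \<rightarrow>\<^sub>E {-1, 0, 1})"
      using ext_space_case_sum_iff[of "s \<circ> Inl" "s \<circ> Inr"] by simp
  qed (auto simp: ext_space_case_sum_iff o_def fun_eq_iff surjective_sum)
  also have "\<dots> = (\<Sum>\<sigma>\<in>ising_space A a. \<Sum>\<kappa>\<in>E \<rightarrow>\<^sub>E {-1, 0, 1}. weight b (case_sum \<sigma> \<kappa>) * f \<sigma>)"
    by (rule sum.cartesian_product[symmetric])
  also have "\<dots> = (\<Sum>\<sigma>\<in>ising_space A a. boltzmann b \<sigma> * f \<sigma>)"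
    by (rule sum.cong) (simp_all add: sum_weight_fibre[OF assms] flip: sum_distrib_right)
  finally show ?thesis .
qed

lemma ising_space_nonempty:
  assumes "a \<in> {-1, 1}" "A \<subseteq> V"
  shows "ising_space A a \<noteq> {}"
proof -
  have "(\<lambda>v\<in>V. a) \<in> ising_space A a"
    using assms by (auto simp: ising_space_def ising_configs_def)
  then show ?thesis
    by blast
qed

lemma sum_boltzmann_pos:
  assumes "a \<in> {-1, 1}" "A \<subseteq> V"
  shows "0 < (\<Sum>\<sigma>\<in>ising_space A a. boltzmann b \<sigma>)"
  using assms by (intro sum_pos finite_ising_space ising_space_nonempty) auto

lemma sum_weight: "b > 0 \<Longrightarrow>
    (\<Sum>s\<in>ext_space A a. weight b s) = (\<Sum>\<sigma>\<in>ising_space A a. boltzmann b \<sigma>)"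
  using sum_weight_marginal[where f = "\<lambda>_. 1"] by simp

lemma sum_weight_pos:
  "b > 0 \<Longrightarrow> a \<in> {-1, 1} \<Longrightarrow> A \<subseteq> V \<Longrightarrow> 0 < (\<Sum>s\<in>ext_space A a. weight b s)"
  using sum_boltzmann_pos by (simp add: sum_weight)

text \<open>\<open>override_on s s' C\<close> takes the values of \<open>s'\<close> on
  \<open>C\<close>. At each incidence the two factors are kept or exchanged as a pair: if only one
  end lies in \<open>C\<close>, agreement of \<open>s\<close> and \<open>s'\<close> at either end
  makes the mixed factors the original ones in some order. The field exponents add up to a symmetric
  sum over vertices.\<close>

lemma weight_override_on:
  assumes "\<And>v e. e \<in> E \<Longrightarrow> v \<in> e \<Longrightarrow>
    (Inl v \<in> C \<longleftrightarrow> Inr e \<in> C) \<or> (s (Inl v) = s' (Inl v)) \<or> s (Inr e) = s' (Inr e)"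
  shows "weight b (override_on s s' C) * weight b (override_on s' s C) = weight b s * weight b s'"
proof -
  have prods: "(\<Prod>(v, e)\<in>incidences. W J b (override_on s s' C (Inl v)) (override_on s s' C (Inr e)))
      * (\<Prod>(v, e)\<in>incidences. W J b (override_on s' s C (Inl v)) (override_on s' s C (Inr e)))
    = (\<Prod>(v, e)\<in>incidences. W J b (s (Inl v)) (s (Inr e)))
      * (\<Prod>(v, e)\<in>incidences. W J b (s' (Inl v)) (s' (Inr e)))"
    unfolding prod.distrib[symmetric] using assms
    by (intro prod.cong) (fastforce simp: override_on_def)+
  have fields: "exp (b * field_sum (\<lambda>v. override_on s s' C (Inl v)))
      * exp (b * field_sum (\<lambda>v. override_on s' s C (Inl v)))
    = exp (b * field_sum (\<lambda>v. s (Inl v))) * exp (b * field_sum (\<lambda>v. s' (Inl v)))"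
    by (auto simp: override_on_def algebra_simps sum_distrib_left intro!: sum.cong
        simp flip: exp_add sum.distrib)
  show ?thesis
    using arg_cong2[OF prods fields, of "(*)"] by (simp add: ext_weight_def mult_ac)
qed

lemma ext_edge_cases:
  assumes "{x, y} \<in> ext_edges E"
  obtains v e where "e \<in> E" "v \<in> e" "x = Inl v" "y = Inr e"
    | v e where "e \<in> E" "v \<in> e" "y = Inl v" "x = Inr e"
  using assms unfolding ext_edges_def by (auto simp: doubleton_eq_iff)

text \<open>
  A spin and an incident edge variable of a configuration of positive weight do not have opposite
  signs, so the sign of \<open>s - s'\<close> cannot change along a disagreement path.
\<close>

lemma sign_constant_on_cluster:
  assumes "b > 0" "s \<in> ext_space A a" "s' \<in> ext_space A a'" "weight b s \<noteq> 0" "weight b s' \<noteq> 0"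
    and "y \<in> cluster E (disagreement V E s s') x"
  shows "s' y < s y \<longleftrightarrow> s' x < s x"
  using assms(6)
proof (induction rule: cluster_induct)
  case (step y z)
  \<comment> \<open>A nonzero product has no zero factor, and \<open>W\<close> vanishes when a
    nonzero edge value differs from the spin.\<close>
  have factor: "s (Inr e) = 0 \<or> s (Inr e) = s (Inl v)"
    if "s \<in> ext_space A a" "weight b s \<noteq> 0" "e \<in> E" "v \<in> e" for s A a v e
  proof -
    have "W J b (s (Inl v)) (s (Inr e)) \<noteq> 0"
      using that finite_incidences by (force simp: ext_weight_def prod_zero_iff)
    then show ?thesis
      using that edge_subset W_eq[OF assms(1) J_pos] ext_space_spin_nonzero by (metis subsetD)
  qed
  \<comment> \<open>If the differing spins are 1 and -1, the edge variables lie in {0, 1} and {0,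
    -1} respectively; being distinct, they are ordered like the spins.\<close>
  have key: "s' (Inl v) < s (Inl v) \<longleftrightarrow> s' (Inr e) < s (Inr e)"
    if "e \<in> E" "v \<in> e" "s (Inl v) \<noteq> s' (Inl v)" "s (Inr e) \<noteq> s' (Inr e)" for v e
    using that edge_subset[OF that(1)] factor[OF assms(2,4) that(1,2)] factor[OF assms(3,5) that(1,2)]
      ext_space_spin[OF assms(2), of v] ext_space_spin[OF assms(3), of v]
    by fastforce
  show ?case
    using step key by (cases rule: ext_edge_cases[OF step(3)]) (auto simp: disagreement_def)
qed simp

text \<open>
  Exchanging the two configurations on the disagreement cluster of \<open>u\<close> preserves the product weight
  and the boundary values, and changes the sign of \<open>s u - s' u\<close>.
\<close>

lemma sum_disconnected_eq_0:
  assumes "u \<in> V" "Inl ` A \<subseteq> B \<or> a = a'"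
    and k: "\<And>s s' t t'. (\<And>x. x \<in> B \<Longrightarrow> t x = s x \<and> t' x = s' x) \<Longrightarrow> k t t' = k s s'"
  shows "(\<Sum>(s, s')\<in>{(s, s') \<in> ext_space A a \<times> ext_space A a'.
      \<not> connected_within E (disagreement V E s s') {Inl u} B}.
    weight b s * weight b s' * ((s (Inl u) - s' (Inl u)) * k s s')) = (0 :: real)"
    (is "sum ?F ?N = 0")
proof -
  define C where "C = (\<lambda>(s, s'). cluster E (disagreement V E s s') (Inl u))"
  define \<Phi> where "\<Phi> = (\<lambda>(s, s'). (override_on s s' (C (s, s')), override_on s' s (C (s, s'))))"
  have C_\<Phi>: "C (\<Phi> p) = C p" for p
    by (simp add: C_def \<Phi>_def split_def disagreement_override_on)
  have \<Phi>_\<Phi>: "\<Phi> (\<Phi> p) = p" for p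
    using C_\<Phi>[of p] by (auto simp: \<Phi>_def split_def override_on_def fun_eq_iff prod_eq_iff)
  have N_iff: "(s, s') \<in> ?N \<longleftrightarrow> s \<in> ext_space A a \<and> s' \<in> ext_space A a' \<and> C (s, s') \<inter> B = {}" for s s'
    by (auto simp: C_def connected_within_iff_cluster)
  have \<Phi>_N: "\<Phi> p \<in> ?N" if p: "p \<in> ?N" for p
  proof -
    obtain s s' where [simp]: "p = (s, s')"
      by (cases p)
    have mem: "s \<in> ext_space A a" "s' \<in> ext_space A a'" and disj: "C p \<inter> B = {}"
      using p N_iff by auto
    \<comment> \<open>Either \<open>B\<close> contains the boundary vertices, which the cluster then
      avoids, or \<open>a = a'\<close> and the exchanged values obey the same condition.\<close>
    have "override_on s s' (C p) \<in> ext_space A a" "override_on s' s (C p) \<in> ext_space A a'"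
      using mem disj assms(2)
      by (auto simp: ext_space_def ext_configs_def override_on_def PiE_iff extensional_def image_subset_iff)
    then show ?thesis
      using disj C_\<Phi>[of p] unfolding \<Phi>_def by (simp add: connected_within_iff_cluster C_def)
  qed
  have \<Phi>_F: "?F (\<Phi> p) = - ?F p" if p: "p \<in> ?N" for p
  proof -
    obtain s s' where [simp]: "p = (s, s')"
      by (cases p)
    have disj: "C p \<inter> B = {}"
      using p N_iff by auto
    have "weight b (override_on s s' (C p)) * weight b (override_on s' s (C p)) = weight b s * weight b s'"
    proof (rule weight_override_on)
      \<comment> \<open>An edge leaving the cluster ends at a point of agreement, since a
        disagreeing neighbour of the cluster belongs to it.\<close>
      fix v e assume "e \<in> E" "v \<in> e"
      then have "{Inl v, Inr e} \<in> ext_edges E" "{Inr e, Inl v} \<in> ext_edges E"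
        "Inl v \<in> ext_verts V E" "Inr e \<in> ext_verts V E"
        using edge_subset by (auto simp: ext_edges_def ext_verts_def)
      then show "(Inl v \<in> C p \<longleftrightarrow> Inr e \<in> C p) \<or> s (Inl v) = s' (Inl v) \<or> s (Inr e) = s' (Inr e)"
        using cluster_closed[of _ E "disagreement V E s s'" "Inl u"]
        by (auto simp: C_def disagreement_def)
    qed
    \<comment> \<open>If the configurations disagree at \<open>u\<close>, then \<open>u\<close> lies
      in its own cluster and its spins are exchanged; otherwise both differences are 0.\<close>
    moreover have "override_on s s' (C p) (Inl u) - override_on s' s (C p) (Inl u)
        = - (s (Inl u) - s' (Inl u))"
      using assms(1) source_mem_cluster[of "Inl u" "disagreement V E s s'" E]
      by (auto simp: override_on_def C_def disagreement_def ext_verts_def)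
    \<comment> \<open>\<open>k\<close> reads only the values on \<open>B\<close>, which the cluster
      avoids.\<close>
    moreover have "k (override_on s s' (C p)) (override_on s' s (C p)) = k s s'"
      using disj by (intro k) (auto simp: override_on_def)
    ultimately show ?thesis
      by (simp only: \<open>p = (s, s')\<close> \<Phi>_def prod.case mult_minus_left mult_minus_right)
  qed
  have "sum ?F ?N = (\<Sum>p\<in>?N. ?F (\<Phi> p))"
    by (rule sum.reindex_bij_witness[of _ \<Phi> \<Phi>]) (simp_all only: \<Phi>_\<Phi> \<Phi>_N)
  also have "\<dots> = - sum ?F ?N"
    unfolding sum_negf[symmetric] by (rule sum.cong) (simp_all only: \<Phi>_F)
  finally show ?thesis
    by linarith
qed

text \<open>Disconnected pairs cancel by exchange, and each connected pair of nonzero weight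
  contributes the constant \<open>c\<close>; pairs of zero weight vanish on both sides. For the
  correlation \<open>k\<close> is the spin difference at the second vertex, for the magnetization it
  is 1.\<close>

lemma sum_connected:
  assumes "u \<in> V" "Inl ` A \<subseteq> B \<or> a = a'"
    and k: "\<And>s s' t t'. (\<And>x. x \<in> B \<Longrightarrow> t x = s x \<and> t' x = s' x) \<Longrightarrow> k t t' = k s s'"
    and c: "\<And>s s'. s \<in> ext_space A a \<Longrightarrow> s' \<in> ext_space A a' \<Longrightarrow> weight b s \<noteq> 0 \<Longrightarrow> weight b s' \<noteq> 0 \<Longrightarrow>
      connected_within E (disagreement V E s s') {Inl u} B \<Longrightarrow> (s (Inl u) - s' (Inl u)) * k s s' = c"
  shows "(\<Sum>(s, s')\<in>ext_space A a \<times> ext_space A a'.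
      weight b s * weight b s' * ((s (Inl u) - s' (Inl u)) * k s s'))
    = c * (\<Sum>(s, s')\<in>ext_space A a \<times> ext_space A a'. weight b s * weight b s'
        * of_bool (connected_within E (disagreement V E s s') {Inl u} B))"
    (is "sum ?F ?P = c * sum ?G ?P")
proof -
  define N where "N = {(s, s') \<in> ?P. \<not> connected_within E (disagreement V E s s') {Inl u} B}"
  have fin: "finite ?P"
    by (simp add: finite_ext_space)
  have N: "N \<subseteq> ?P"
    by (auto simp: N_def)
  have "sum ?F ?P = sum ?F (?P - N) + sum ?F N"
    by (rule sum.subset_diff[OF N fin])
  also have "sum ?F N = 0"
    unfolding N_def by (rule sum_disconnected_eq_0[OF assms(1,2) k])
  also have "sum ?F (?P - N) = (\<Sum>p\<in>?P - N. c * ?G p)"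
    using c by (intro sum.cong) (auto simp: N_def)
  also have "\<dots> = (\<Sum>p\<in>?P. c * ?G p)"
    by (rule sum.mono_neutral_left) (auto simp: N_def fin)
  finally show ?thesis
    by (simp add: sum_distrib_left)
qed

subsection \<open>Laws with boundary values\<close>

lemma cond_ising_fin:
  assumes "a \<in> {-1, 1}" "A \<subseteq> V"
  shows "cond_pmf (ising_fin V E J h \<epsilon> \<eta> b) {\<sigma>. \<forall>v\<in>A. \<sigma> v = a}
    = proportional_pmf (ising_space A a) (boltzmann b)"
  unfolding ising_fin_def ising_space_def
  using finite_ising_space[of "{}" a] sum_boltzmann_pos[OF assms, of b]
  by (intro cond_proportional_pmf) (auto simp: ising_space_def)

lemma cond_ext_fin:
  assumes "b > 0" "a \<in> {-1, 1}" "A \<subseteq> V"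
  shows "cond_pmf (ext_fin V E J h \<epsilon> \<eta> b) {s. \<forall>v\<in>A. s (Inl v) = a}
    = proportional_pmf (ext_space A a) (weight b)"
  unfolding ext_fin_def ext_space_def
  using finite_ext_space[of "{}" a] sum_weight_pos[OF assms] weight_nonneg[OF assms(1), of _ "{}" a]
  by (intro cond_proportional_pmf) (auto simp: ext_space_def)

text \<open>The Boltzmann weight is a pure exponential with rate minus the Hamiltonian, so the
  rescaled weight is constantly 1.\<close>

lemma converging_laws_ising:
  assumes "a \<in> {-1, 1}" "A \<subseteq> V"
  shows "converging_laws (\<lambda>b. cond_pmf (ising_fin V E J h \<epsilon> \<eta> b) {\<sigma>. \<forall>v\<in>A. \<sigma> v = a})
    (ising_space A a)"
  using assms
  by (intro converging_laws_proportional_pmf[where w = boltzmann and L = "\<lambda>_. 1"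
        and c = "\<lambda>\<sigma>. - hamiltonian V E J h \<epsilon> \<eta> \<sigma>"])
    (simp_all only: cond_ising_fin sum_boltzmann_pos finite_ising_space, simp_all flip: exp_add)

text \<open>Rates add over factors: each incidence contributes its rate from
  \<open>W_tendsto\<close>, and the field term cancels exactly. The limit indicates that every
  nonzero edge variable equals both incident spins.\<close>

lemma weight_tendsto:
  assumes "s \<in> ext_space A a"
  shows "((\<lambda>b. weight b s * exp (- (b *
      ((\<Sum>(v, e)\<in>incidences. if s (Inr e) = 0 then - J / 2 else J / 2) + field_sum (\<lambda>v. s (Inl v))))))
    \<longlongrightarrow> (\<Prod>(v, e)\<in>incidences. of_bool (s (Inr e) = 0 \<or> s (Inl v) = s (Inr e)))) at_top"
    (is "((\<lambda>b. weight b s * exp (- (b * (sum ?c _ + _)))) \<longlongrightarrow> _) _")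
proof -
  have "weight b s * exp (- (b * (sum ?c incidences + field_sum (\<lambda>v. s (Inl v)))))
      = (\<Prod>i\<in>incidences. (case i of (v, e) \<Rightarrow> W J b (s (Inl v)) (s (Inr e))) * exp (- (b * ?c i)))" for b
    unfolding prod.distrib exp_sum[OF finite_incidences, symmetric] sum_negf
      sum_distrib_left[symmetric] ext_weight_def
    by (simp add: mult.assoc distrib_left flip: exp_add)
  moreover have "((\<lambda>b. \<Prod>i\<in>incidences.
      (case i of (v, e) \<Rightarrow> W J b (s (Inl v)) (s (Inr e))) * exp (- (b * ?c i)))
      \<longlongrightarrow> (\<Prod>(v, e)\<in>incidences. of_bool (s (Inr e) = 0 \<or> s (Inl v) = s (Inr e)))) at_top"
  proof (rule tendsto_prod)
    fix i assume "i \<in> incidences"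
    then obtain v e where [simp]: "i = (v, e)" and "e \<in> E" "v \<in> e"
      by blast
    then have "s (Inl v) \<noteq> 0"
      using ext_space_spin_nonzero[OF assms] edge_subset by blast
    from W_tendsto[OF J_pos this, of "s (Inr e)"]
    show "((\<lambda>b. (case i of (v, e) \<Rightarrow> W J b (s (Inl v)) (s (Inr e))) * exp (- (b * ?c i)))
        \<longlongrightarrow> (case i of (v, e) \<Rightarrow> of_bool (s (Inr e) = 0 \<or> s (Inl v) = s (Inr e)))) at_top"
      by simp
  qed
  ultimately show ?thesis
    by simp
qed

lemma converging_laws_ext:
  assumes "a \<in> {-1, 1}" "A \<subseteq> V"
  shows "converging_laws (\<lambda>b. cond_pmf (ext_fin V E J h \<epsilon> \<eta> b) {s. \<forall>v\<in>A. s (Inl v) = a})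
    (ext_space A a)"
proof (rule converging_laws_proportional_pmf[where w = weight, OF finite_ext_space _ _ weight_tendsto])
  fix b :: real and s
  assume "b > 0" "s \<in> ext_space A a"
    and "(\<Prod>(v, e)\<in>incidences. of_bool (s (Inr e) = 0 \<or> s (Inl v) = s (Inr e))) = (0 :: real)"
  \<comment> \<open>A zero limit comes from a mismatched incidence, whose factor \<open>W\<close> is
    already 0 at finite \<open>b\<close>.\<close>
  then obtain v e where "e \<in> E" "v \<in> e" "s (Inr e) \<noteq> 0" "s (Inl v) \<noteq> s (Inr e)"
    using finite_incidences by (auto simp: of_bool_def max_def split: if_splits)
  moreover from this have "W J b (s (Inl v)) (s (Inr e)) = 0"
    using ext_space_spin_nonzero[OF \<open>s \<in> ext_space A a\<close>] edge_subset W_eq[OF \<open>b > 0\<close> J_pos] by (metis subsetD)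
  ultimately show "weight b s = 0"
    using finite_incidences unfolding ext_weight_def by force
qed (use assms in \<open>simp_all only: cond_ext_fin sum_weight_pos weight_nonneg\<close>)

section \<open>The identities at finite inverse temperature\<close>

lemma expectation_cond_ising:
  assumes "b > 0" "a \<in> {-1, 1}" "A \<subseteq> V"
  shows "measure_pmf.expectation (cond_pmf (ising_fin V E J h \<epsilon> \<eta> b) {\<sigma>. \<forall>v\<in>A. \<sigma> v = a}) f
    = (\<Sum>s\<in>ext_space A a. weight b s * f (\<lambda>v. s (Inl v))) / (\<Sum>s\<in>ext_space A a. weight b s)"
  unfolding cond_ising_fin[OF assms(2,3)] sum_weight_marginal[OF assms(1)] sum_weight[OF assms(1)]
  by (rule expectation_proportional_pmf[OF finite_ising_space _ sum_boltzmann_pos[OF assms(2,3)]]) simp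

lemma expectation_cond_ext_pair:
  assumes "b > 0" "a \<in> {-1, 1}" "a' \<in> {-1, 1}" "A \<subseteq> V"
  shows "measure_pmf.expectation
      (pair_pmf (cond_pmf (ext_fin V E J h \<epsilon> \<eta> b) {s. \<forall>v\<in>A. s (Inl v) = a})
        (cond_pmf (ext_fin V E J h \<epsilon> \<eta> b) {s. \<forall>v\<in>A. s (Inl v) = a'})) f
    = (\<Sum>(s, s')\<in>ext_space A a \<times> ext_space A a'. weight b s * weight b s' * f (s, s'))
      / ((\<Sum>s\<in>ext_space A a. weight b s) * (\<Sum>s\<in>ext_space A a'. weight b s))"
  unfolding cond_ext_fin[OF assms(1,2,4)] cond_ext_fin[OF assms(1,3,4)]
  by (rule expectation_pair_proportional_pmf[OF finite_ext_space weight_nonneg[OF assms(1)]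
        sum_weight_pos[OF assms(1,2,4)] finite_ext_space weight_nonneg[OF assms(1)]
        sum_weight_pos[OF assms(1,3,4)]])

text \<open>The weighted sum of products of the spin differences at \<open>u\<close> and
  \<open>v\<close> is 4 times the connected mass by \<open>sum_connected\<close> and, when expanded,
  \<open>2 * Z * Z\<close> times the truncated correlation. The quotient of 4 and 2 is the factor in
  the identity.\<close>

lemma truncated_corr_fin:
  fixes b :: real
  assumes "b > 0" "u \<in> V" "v \<in> V"
  defines "p \<equiv> cond_pmf (ising_fin V E J h \<epsilon> \<eta> b) {\<sigma>. \<forall>v\<in>{}. \<sigma> v = 1}"
    and "q \<equiv> cond_pmf (ext_fin V E J h \<epsilon> \<eta> b) {s. \<forall>v\<in>{}. s (Inl v) = 1}"
  shows "truncated_corr p u v = 2 * measure_pmf.expectation (pair_pmf q q)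
    (\<lambda>(s, s'). of_bool (connected_within E (disagreement V E s s') {Inl u} {Inl v}))"
proof -
  \<comment> \<open>The boundary set is empty, so the value 1 is a placeholder.\<close>
  let ?S = "ext_space {} 1"
  define Z where "Z = (\<Sum>s\<in>?S. weight b s)"
  define M where "M f = (\<Sum>s\<in>?S. weight b s * f s)" for f
  have Z: "Z > 0"
    unfolding Z_def by (rule sum_weight_pos) (use assms in auto)
  have E: "measure_pmf.expectation p f = M (\<lambda>s. f (\<lambda>v. s (Inl v))) / Z" for f
    unfolding p_def M_def Z_def by (rule expectation_cond_ising) (use assms in auto)
  have "(\<Sum>(s, s')\<in>?S \<times> ?S. weight b s * weight b s'
      * ((s (Inl u) - s' (Inl u)) * (s (Inl v) - s' (Inl v))))
    = 4 * (\<Sum>(s, s')\<in>?S \<times> ?S. weight b s * weight b s'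
      * of_bool (connected_within E (disagreement V E s s') {Inl u} {Inl v}))"
  proof (rule sum_connected)
    fix s s'
    assume s: "s \<in> ?S" "s' \<in> ?S" "weight b s \<noteq> 0" "weight b s' \<noteq> 0"
      and "connected_within E (disagreement V E s s') {Inl u} {Inl v}"
    then have v: "Inl v \<in> cluster E (disagreement V E s s') (Inl u)"
      by (simp add: connected_within_iff_cluster)
    then have "s (Inl u) \<noteq> s' (Inl u)" "s (Inl v) \<noteq> s' (Inl v)"
      using source_mem_if_mem_cluster[OF v] cluster_subset by (auto simp: disagreement_def)
    \<comment> \<open>Each difference is 2 or -2, and both have the same sign because
      \<open>u\<close> and \<open>v\<close> share a cluster.\<close>
    then show "(s (Inl u) - s' (Inl u)) * (s (Inl v) - s' (Inl v)) = 4"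
      using sign_constant_on_cluster[OF assms(1) s v]
        ext_space_spin[OF s(1), of u] ext_space_spin[OF s(1), of v]
        ext_space_spin[OF s(2), of u] ext_space_spin[OF s(2), of v] assms(2,3) by auto
  qed (use assms in simp_all)
  moreover have "(\<Sum>(s, s')\<in>?S \<times> ?S. weight b s * weight b s'
      * ((s (Inl u) - s' (Inl u)) * (s (Inl v) - s' (Inl v))))
    = 2 * (Z * M (\<lambda>s. s (Inl u) * s (Inl v)) - M (\<lambda>s. s (Inl u)) * M (\<lambda>s. s (Inl v)))"
  proof -
    have "(\<Sum>(s, s')\<in>?S \<times> ?S. weight b s * weight b s'
        * ((s (Inl u) - s' (Inl u)) * (s (Inl v) - s' (Inl v))))
      = (\<Sum>s\<in>?S. \<Sum>s'\<in>?S. (weight b s * (s (Inl u) * s (Inl v))) * weight b s'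
          + weight b s * (weight b s' * (s' (Inl u) * s' (Inl v)))
          - ((weight b s * s (Inl u)) * (weight b s' * s' (Inl v))
            + (weight b s * s (Inl v)) * (weight b s' * s' (Inl u))))"
      unfolding sum.cartesian_product by (intro sum.cong) (auto simp: algebra_simps)
    also have "\<dots> = 2 * (Z * M (\<lambda>s. s (Inl u) * s (Inl v)) - M (\<lambda>s. s (Inl u)) * M (\<lambda>s. s (Inl v)))"
      by (simp only: sum.distrib sum_subtractf sum_product[symmetric] Z_def[symmetric] M_def[symmetric])
        (simp add: algebra_simps)
    finally show ?thesis .
  qed
  moreover have "measure_pmf.expectation (pair_pmf q q)
      (\<lambda>(s, s'). of_bool (connected_within E (disagreement V E s s') {Inl u} {Inl v}))
    = (\<Sum>(s, s')\<in>?S \<times> ?S. weight b s * weight b s'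
      * of_bool (connected_within E (disagreement V E s s') {Inl u} {Inl v})) / (Z * Z)"
    unfolding q_def Z_def by (subst expectation_cond_ext_pair) (use assms in auto)
  ultimately show ?thesis
    using Z unfolding truncated_corr_def E by (simp add: field_simps)
qed

text \<open>With \<open>k\<close> constantly 1, the sum of the spin differences at \<open>u\<close>
  is \<open>M 1 * Z (-1) - Z 1 * M (-1)\<close>, which after division by both partition functions is
  the difference of the magnetizations. The constant 2 of \<open>sum_connected\<close> cancels the
  half.\<close>

lemma magnetization_fin:
  fixes b :: real
  assumes "b > 0" "A \<subseteq> V" "u \<in> V"
  defines "p \<equiv> (\<lambda>a. cond_pmf (ising_fin V E J h \<epsilon> \<eta> b) {\<sigma>. \<forall>v\<in>A. \<sigma> v = a})"
    and "q \<equiv> (\<lambda>a. cond_pmf (ext_fin V E J h \<epsilon> \<eta> b) {s. \<forall>v\<in>A. s (Inl v) = a})"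
  shows "(1 / 2) * (measure_pmf.expectation (p 1) (\<lambda>\<sigma>. \<sigma> u) - measure_pmf.expectation (p (-1)) (\<lambda>\<sigma>. \<sigma> u))
    = measure_pmf.expectation (pair_pmf (q 1) (q (-1)))
      (\<lambda>(s, s'). of_bool (connected_within E (disagreement V E s s') {Inl u} (Inl ` A)))"
proof -
  let ?S = "ext_space A"
  define Z where "Z a = (\<Sum>s\<in>?S a. weight b s)" for a
  define M where "M a = (\<Sum>s\<in>?S a. weight b s * s (Inl u))" for a
  have Z: "Z 1 > 0" "Z (-1) > 0"
    unfolding Z_def using assms by (auto intro!: sum_weight_pos)
  have E: "measure_pmf.expectation (p a) (\<lambda>\<sigma>. \<sigma> u) = M a / Z a" if "a \<in> {-1, 1}" for a
    unfolding p_def M_def Z_def using that assms by (intro expectation_cond_ising) auto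
  have "(\<Sum>(s, s')\<in>?S 1 \<times> ?S (-1). weight b s * weight b s' * ((s (Inl u) - s' (Inl u)) * 1))
    = 2 * (\<Sum>(s, s')\<in>?S 1 \<times> ?S (-1). weight b s * weight b s'
      * of_bool (connected_within E (disagreement V E s s') {Inl u} (Inl ` A)))"
  proof (rule sum_connected)
    fix s s'
    assume s: "s \<in> ?S 1" "s' \<in> ?S (-1)" "weight b s \<noteq> 0" "weight b s' \<noteq> 0"
      and "connected_within E (disagreement V E s s') {Inl u} (Inl ` A)"
    then obtain v where "v \<in> A" and v: "Inl v \<in> cluster E (disagreement V E s s') (Inl u)"
      by (auto simp: connected_within_iff_cluster)
    \<comment> \<open>On \<open>A\<close> the first copy is 1 and the second is -1. This fixes the
      sign on the whole cluster, so the difference at \<open>u\<close> is 2 and not -2.\<close>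
    then have "s' (Inl v) < s (Inl v)"
      using s by (auto simp: ext_space_def)
    then show "(s (Inl u) - s' (Inl u)) * 1 = 2"
      using sign_constant_on_cluster[OF assms(1) s v]
        ext_space_spin[OF s(1) assms(3)] ext_space_spin[OF s(2) assms(3)] by auto
  qed (use assms in simp_all)
  moreover have "(\<Sum>(s, s')\<in>?S 1 \<times> ?S (-1). weight b s * weight b s' * ((s (Inl u) - s' (Inl u)) * 1))
    = M 1 * Z (-1) - Z 1 * M (-1)"
    unfolding M_def Z_def sum_product sum_subtractf[symmetric] sum.cartesian_product
    by (intro sum.cong) (auto simp: algebra_simps)
  moreover have "measure_pmf.expectation (pair_pmf (q 1) (q (-1)))
      (\<lambda>(s, s'). of_bool (connected_within E (disagreement V E s s') {Inl u} (Inl ` A)))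
    = (\<Sum>(s, s')\<in>?S 1 \<times> ?S (-1). weight b s * weight b s'
      * of_bool (connected_within E (disagreement V E s s') {Inl u} (Inl ` A))) / (Z 1 * Z (-1))"
    unfolding q_def Z_def by (subst expectation_cond_ext_pair) (use assms in auto)
  ultimately show ?thesis
    using Z by (simp add: E field_simps)
qed

text \<open>Reversing all spins swaps the two boundary conditions and preserves the Hamiltonian when
  the total field vanishes. This identifies half the difference of the magnetizations with the plus
  magnetization.\<close>

lemma magnetization_symmetric_fin:
  fixes b :: real
  assumes "A \<subseteq> V" "u \<in> V" "\<forall>v\<in>V. h + \<epsilon> * \<eta> v = 0"
  defines "p \<equiv> (\<lambda>a. cond_pmf (ising_fin V E J h \<epsilon> \<eta> b) {\<sigma>. \<forall>v\<in>A. \<sigma> v = a})"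
  shows "measure_pmf.expectation (p (-1)) (\<lambda>\<sigma>. \<sigma> u) = - measure_pmf.expectation (p 1) (\<lambda>\<sigma>. \<sigma> u)"
proof -
  \<comment> \<open>Restricting to \<open>V\<close> keeps the reversed configuration
    \<open>undefined\<close> off \<open>V\<close>, hence inside the configuration space.\<close>
  define flip where "flip \<sigma> = (\<lambda>v\<in>V. - \<sigma> v)" for \<sigma> :: "'v \<Rightarrow> real"
  have flip_mem: "flip \<sigma> \<in> ising_space A (- a)" if "\<sigma> \<in> ising_space A a" for \<sigma> a
    using that assms(1) by (auto simp: flip_def ising_space_def ising_configs_def PiE_iff)
  have flip_flip: "flip (flip \<sigma>) = \<sigma>" if "\<sigma> \<in> ising_space A a" for \<sigma> a
    using that by (auto simp: flip_def ising_space_def ising_configs_def PiE_iff extensional_def fun_eq_iff)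
  have hamiltonian_flip: "hamiltonian V E J h \<epsilon> \<eta> (flip \<sigma>) = hamiltonian V E J h \<epsilon> \<eta> \<sigma>" for \<sigma>
  proof -
    have "(\<Prod>w\<in>e. flip \<sigma> w) = (\<Prod>w\<in>e. \<sigma> w)" if e: "e \<in> E" for e
    proof -
      have "(\<Prod>w\<in>e. flip \<sigma> w) = (\<Prod>w\<in>e. - \<sigma> w)"
        using edge_subset[OF e] by (intro prod.cong) (auto simp: flip_def)
      \<comment> \<open>An edge has two vertices, so the two sign changes cancel.\<close>
      then show ?thesis
        by (simp add: prod_uminus card_edge[OF e])
    qed
    then show ?thesis
      using assms(3) by (simp add: hamiltonian_def)
  qed
  have sum_flip: "(\<Sum>\<sigma>\<in>ising_space A (-1). boltzmann b \<sigma> * f \<sigma>)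
      = (\<Sum>\<sigma>\<in>ising_space A 1. boltzmann b \<sigma> * f (flip \<sigma>))" for f
    using flip_mem[of _ 1] flip_mem[of _ "-1"]
    by (intro sum.reindex_bij_witness[of _ flip flip]) (auto simp: flip_flip hamiltonian_flip)
  have flip_u: "flip \<sigma> u = - \<sigma> u" for \<sigma>
    using assms(2) by (simp add: flip_def)
  have E: "measure_pmf.expectation (p a) (\<lambda>\<sigma>. \<sigma> u)
      = (\<Sum>\<sigma>\<in>ising_space A a. boltzmann b \<sigma> * \<sigma> u) / (\<Sum>\<sigma>\<in>ising_space A a. boltzmann b \<sigma> * 1)"
    if "a \<in> {-1, 1}" for a
    unfolding p_def cond_ising_fin[OF that assms(1)]
    using that assms(1)
    by (subst expectation_proportional_pmf[OF finite_ising_space _ sum_boltzmann_pos[OF that assms(1)]]) simp_all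
  show ?thesis
    by (simp only: E insert_iff simp_thms sum_flip flip_u mult_minus_right sum_negf minus_divide_left)
qed

end

section \<open>All inverse temperatures, including the infinite one\<close>

theorem proposition3p1:
  fixes V :: "'v set" and E :: "'v set set" and \<eta> :: "'v \<Rightarrow> real"
    and J h \<epsilon> :: real and \<beta> :: ereal
  assumes "fin_graph V E" and "J > 0" and "\<epsilon> > 0" and "\<beta> > 0"
  shows "(\<forall>u\<in>V. \<forall>v\<in>V.
      truncated_corr (ising V E J h \<epsilon> \<eta> \<beta>) u v =
        2 * measure_pmf.expectation (pair_pmf (ext_law V E J h \<epsilon> \<eta> \<beta>) (ext_law V E J h \<epsilon> \<eta> \<beta>))
              (\<lambda>(s, s'). of_bool (connected_within E (disagreement V E s s') {Inl u} {Inl v})))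
    \<and> (\<forall>A u. A \<subseteq> V \<and> u \<in> V \<longrightarrow>
      (1 / 2) * (measure_pmf.expectation (ising_bc V E J h \<epsilon> \<eta> A 1 \<beta>) (\<lambda>\<sigma>. \<sigma> u)
         - measure_pmf.expectation (ising_bc V E J h \<epsilon> \<eta> A (-1) \<beta>) (\<lambda>\<sigma>. \<sigma> u)) =
        measure_pmf.expectation
          (pair_pmf (ext_bc V E J h \<epsilon> \<eta> A 1 \<beta>) (ext_bc V E J h \<epsilon> \<eta> A (-1) \<beta>))
          (\<lambda>(s, s'). of_bool (connected_within E (disagreement V E s s') {Inl u} (Inl ` A)))
      \<and> ((\<forall>v\<in>V. h + \<epsilon> * \<eta> v = 0) \<longrightarrow>
          measure_pmf.expectation (ising_bc V E J h \<epsilon> \<eta> A 1 \<beta>) (\<lambda>\<sigma>. \<sigma> u) =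
            (1 / 2) * (measure_pmf.expectation (ising_bc V E J h \<epsilon> \<eta> A 1 \<beta>) (\<lambda>\<sigma>. \<sigma> u)
               - measure_pmf.expectation (ising_bc V E J h \<epsilon> \<eta> A (-1) \<beta>) (\<lambda>\<sigma>. \<sigma> u))))"
proof -
  interpret extended_ising V E J h \<epsilon> \<eta>
    by unfold_locales (use assms in auto)
  \<comment> \<open>The inverse temperature comes last, so that \<open>p A a\<close> is a family to
    which \<open>at_inv_temp\<close> applies.\<close>
  define p where "p A a b = cond_pmf (ising_fin V E J h \<epsilon> \<eta> b) {\<sigma>. \<forall>v\<in>A. \<sigma> v = a}" for A a b
  define q where "q A a b = cond_pmf (ext_fin V E J h \<epsilon> \<eta> b) {s. \<forall>v\<in>A. s (Inl v) = a}" for A a b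
  have laws: "ising V E J h \<epsilon> \<eta> \<beta> = at_inv_temp (p {} 1) \<beta>" "ext_law V E J h \<epsilon> \<eta> \<beta> = at_inv_temp (q {} 1) \<beta>"
    "ising_bc V E J h \<epsilon> \<eta> A a \<beta> = at_inv_temp (p A a) \<beta>" "ext_bc V E J h \<epsilon> \<eta> A a \<beta> = at_inv_temp (q A a) \<beta>" for A a
    by (simp_all add: ising_def ext_law_def ising_bc_def ext_bc_def p_def[abs_def] q_def[abs_def] cond_pmf_UNIV)
  have p_lim: "((\<lambda>b. measure_pmf.expectation (p A a b) f)
      \<longlongrightarrow> measure_pmf.expectation (at_inv_temp (p A a) \<infinity>) f) at_top"
    if "a \<in> {-1, 1}" "A \<subseteq> V" for A a and f :: "('v \<Rightarrow> real) \<Rightarrow> real"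
    unfolding p_def by (rule tendsto_expectation_at_inv_temp[OF converging_laws_ising[OF that]])
  have q_lim: "((\<lambda>b. measure_pmf.expectation (pair_pmf (q A a b) (q A a' b)) f)
      \<longlongrightarrow> measure_pmf.expectation (pair_pmf (at_inv_temp (q A a) \<infinity>) (at_inv_temp (q A a') \<infinity>)) f) at_top"
    if "a \<in> {-1, 1}" "a' \<in> {-1, 1}" "A \<subseteq> V" for A a a' and f :: "('v + 'v set \<Rightarrow> real) \<times> ('v + 'v set \<Rightarrow> real) \<Rightarrow> real"
    unfolding q_def
    by (rule tendsto_expectation_pair_at_inv_temp[OF converging_laws_ext converging_laws_ext]) (use that in auto)
  \<comment> \<open>At finite \<open>\<beta>\<close> this is an instance of \<open>fin\<close>; at
    infinity both sides are limits of functions that agree for positive \<open>b\<close>.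
    \<open>F\<close> and \<open>G\<close> take all laws at once so that one argument serves the
    three identities.\<close>
  have to_limit: "F (\<lambda>A a. at_inv_temp (p A a) \<beta>) (\<lambda>A a. at_inv_temp (q A a) \<beta>)
      = G (\<lambda>A a. at_inv_temp (p A a) \<beta>) (\<lambda>A a. at_inv_temp (q A a) \<beta>)"
    if fin: "\<And>b. b > 0 \<Longrightarrow> F (\<lambda>A a. p A a b) (\<lambda>A a. q A a b) = G (\<lambda>A a. p A a b) (\<lambda>A a. q A a b)"
      and F: "((\<lambda>b. F (\<lambda>A a. p A a b) (\<lambda>A a. q A a b))
        \<longlongrightarrow> F (\<lambda>A a. at_inv_temp (p A a) \<infinity>) (\<lambda>A a. at_inv_temp (q A a) \<infinity>)) at_top"
      and G: "((\<lambda>b. G (\<lambda>A a. p A a b) (\<lambda>A a. q A a b))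
        \<longlongrightarrow> G (\<lambda>A a. at_inv_temp (p A a) \<infinity>) (\<lambda>A a. at_inv_temp (q A a) \<infinity>)) at_top"
    for F G :: "('v set \<Rightarrow> real \<Rightarrow> ('v \<Rightarrow> real) pmf) \<Rightarrow> ('v set \<Rightarrow> real \<Rightarrow> ('v + 'v set \<Rightarrow> real) pmf) \<Rightarrow> real"
  proof (cases "\<beta> = \<infinity>")
    case True
    have "\<forall>\<^sub>F b in at_top. F (\<lambda>A a. p A a b) (\<lambda>A a. q A a b) = G (\<lambda>A a. p A a b) (\<lambda>A a. q A a b)"
      using eventually_gt_at_top[of 0] by eventually_elim (rule fin)
    then show ?thesis
      unfolding True using F G by (intro tendsto_unique[OF _ Lim_transform_eventually]) auto
  next
    case False
    then obtain b where "\<beta> = ereal b" "b > 0"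
      using assms(4) by (cases \<beta>) auto
    then show ?thesis
      using fin by (simp add: at_inv_temp_def)
  qed
  show ?thesis
    unfolding laws
  proof (intro conjI allI impI ballI, goal_cases)
    case (1 u v)
    let ?f = "\<lambda>(s, s'). of_bool (connected_within E (disagreement V E s s') {Inl u} {Inl v})"
    show ?case
    proof (rule to_limit[where F = "\<lambda>p q. truncated_corr (p {} 1) u v"
          and G = "\<lambda>p q. 2 * measure_pmf.expectation (pair_pmf (q {} 1) (q {} 1)) ?f"])
      show "truncated_corr (p {} 1 b) u v
          = 2 * measure_pmf.expectation (pair_pmf (q {} 1 b) (q {} 1 b)) ?f" if "b > 0" for b
        unfolding p_def q_def by (rule truncated_corr_fin[OF that 1])
    qed (unfold truncated_corr_def, (intro tendsto_intros p_lim q_lim; simp)+)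
  next
    case (2 A u)
    then have A: "A \<subseteq> V" and u: "u \<in> V"
      by auto
    let ?f = "\<lambda>(s, s'). of_bool (connected_within E (disagreement V E s s') {Inl u} (Inl ` A))"
    show ?case
    proof (rule to_limit[where F = "\<lambda>p q. (1 / 2) * (measure_pmf.expectation (p A 1) (\<lambda>\<sigma>. \<sigma> u)
            - measure_pmf.expectation (p A (-1)) (\<lambda>\<sigma>. \<sigma> u))"
          and G = "\<lambda>p q. measure_pmf.expectation (pair_pmf (q A 1) (q A (-1))) ?f"])
      show "(1 / 2) * (measure_pmf.expectation (p A 1 b) (\<lambda>\<sigma>. \<sigma> u)
            - measure_pmf.expectation (p A (-1) b) (\<lambda>\<sigma>. \<sigma> u))
          = measure_pmf.expectation (pair_pmf (q A 1 b) (q A (-1) b)) ?f" if "b > 0" for b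
        unfolding p_def q_def by (rule magnetization_fin[OF that A u])
    qed (intro tendsto_intros p_lim q_lim; simp add: A)+
  next
    case (3 A u)
    then have A: "A \<subseteq> V" and u: "u \<in> V"
      by auto
    \<comment> \<open>With the minus magnetization equal to the negated plus magnetization, half
      their difference is the plus magnetization.\<close>
    have "measure_pmf.expectation (at_inv_temp (p A (-1)) \<beta>) (\<lambda>\<sigma>. \<sigma> u)
      = - measure_pmf.expectation (at_inv_temp (p A 1) \<beta>) (\<lambda>\<sigma>. \<sigma> u)"
    proof (rule to_limit[where F = "\<lambda>p q. measure_pmf.expectation (p A (-1)) (\<lambda>\<sigma>. \<sigma> u)"
          and G = "\<lambda>p q. - measure_pmf.expectation (p A 1) (\<lambda>\<sigma>. \<sigma> u)"])
      show "measure_pmf.expectation (p A (-1) b) (\<lambda>\<sigma>. \<sigma> u)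
          = - measure_pmf.expectation (p A 1 b) (\<lambda>\<sigma>. \<sigma> u)" for b
        unfolding p_def by (rule magnetization_symmetric_fin[OF A u 3(2)])
    qed (intro tendsto_intros p_lim; simp add: A)+
    then show ?case
      by simp
  qed
qed

end
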